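(* If $G$ is a graph on $n$ vertices with no isolated vertices, then $\operatorname{cr}(G)\le 3n$.
   Context: All graphs are finite, simple, undirected and labelled. A bicoloration (bicoloring) of a graph $G$ is a map $\beta:V(G)\to\{-1,1\}$, and a bicolored graph is a pair $B=(G,\beta)$. The local complement $G*a$ of $G$ at a vertex $a$ is obtained from $G$ by complementing the subgraph induced by the open neighborhood $N_G(a)$ and leaving all other adjacencies unchanged. The local inversion of $B=(G,\beta)$ at $a\in V(G)$ is $B_a=(G*a,\beta_a)$, where $\beta_a(x)=-\beta(x)$ if $x\in N_G(a)$ and $\beta_a(x)=\beta(x)$ otherwise. A string is a finite (possibly empty) sequence of vertices of $G$ (repetitions allowed); for a string $w=x_1\cdots x_k$ its length is $|w|=k$, and $B_w$ is the bicolored graph obtained from $B$ by applying the local inversions at $x_1,\ldots,x_k$ in this order, each neighborhood being taken in the current underlying graph. The color-reversal number $\operatorname{cr}(G)$ is the minimum length of a string $w$ of vertices of $G$ such that, for every bicoloring $\beta$ of $G$, $(G,\beta)_w=(G,-\beta)$, i.e. applying the local inversions in $w$ returns the underlying graph to $G$ and changes every color. (The effect of a fixed string on which colors are changed is independent of the initial coloring, so it is equivalent to require this for one bicoloring.) *)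

theory Defs
  imports
    "Graph_Theory.Pair_Digraph"
    "HOL-Library.Extended_Nat"
    "HOL-Library.FuncSet"
begin

text \<open>
  A finite simple undirected graph is a loopfree symmetric finite digraph, i.e. a
  \<open>pair_graph\<close>: the edge \<open>uv\<close> is represented by the two arcs \<open>(u, v)\<close> and \<open>(v, u)\<close>.
\<close>

definition open_nbhd :: "'a pair_pre_digraph \<Rightarrow> 'a \<Rightarrow> 'a set" where
  "open_nbhd G a = {x \<in> pverts G. (a, x) \<in> parcs G}"

definition local_complement :: "'a pair_pre_digraph \<Rightarrow> 'a \<Rightarrow> 'a pair_pre_digraph" where
  "local_complement G a =
     \<lparr>pverts = pverts G,
      parcs = {(u, v). if u \<in> open_nbhd G a \<and> v \<in> open_nbhd G a
                       then u \<noteq> v \<and> (u, v) \<notin> parcs G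
                       else (u, v) \<in> parcs G}\<rparr>"

text \<open>
  Bicolorings are extensional functions (\<open>undefined\<close> outside the vertex set), so that
  equality of bicolorings in HOL is equality as maps on the vertex set.
\<close>

definition bicolorings :: "'a pair_pre_digraph \<Rightarrow> ('a \<Rightarrow> int) set" where
  "bicolorings G = pverts G \<rightarrow>\<^sub>E {-1, 1}"

definition color_negation :: "'a pair_pre_digraph \<Rightarrow> ('a \<Rightarrow> int) \<Rightarrow> ('a \<Rightarrow> int)" where
  "color_negation G \<beta> = (\<lambda>x\<in>pverts G. - \<beta> x)"

type_synonym 'a bicolored_graph = "'a pair_pre_digraph \<times> ('a \<Rightarrow> int)"

fun local_inversion :: "'a bicolored_graph \<Rightarrow> 'a \<Rightarrow> 'a bicolored_graph" where
  "local_inversion (G, \<beta>) a =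
     (local_complement G a, \<lambda>x. if x \<in> open_nbhd G a then - \<beta> x else \<beta> x)"

definition apply_string :: "'a bicolored_graph \<Rightarrow> 'a list \<Rightarrow> 'a bicolored_graph" where
  "apply_string B w = foldl local_inversion B w"

definition color_reversing :: "'a pair_pre_digraph \<Rightarrow> 'a list \<Rightarrow> bool" where
  "color_reversing G w \<longleftrightarrow>
     set w \<subseteq> pverts G \<and>
     (\<forall>\<beta>\<in>bicolorings G. apply_string (G, \<beta>) w = (G, color_negation G \<beta>))"

text \<open>
  The minimum is taken in \<open>enat\<close>: it is \<open>\<infinity>\<close> if there is no color-reversing string,
  so a finite upper bound includes the existence of such a string.
\<close>

definition color_reversal_number :: "'a pair_pre_digraph \<Rightarrow> enat" where
  "color_reversal_number G = (INF w\<in>{w. color_reversing G w}. enat (length w))"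

definition isolated_vertex :: "'a pair_pre_digraph \<Rightarrow> 'a \<Rightarrow> bool" where
  "isolated_vertex G v \<longleftrightarrow> v \<in> pverts G \<and> open_nbhd G v = {}"

lemma pair_graph_local_complement:
  assumes "pair_graph G"
  shows "pair_graph (local_complement G a)"
proof -
  interpret pair_graph G by fact
  have sub: "parcs (local_complement G a) \<subseteq> pverts G \<times> pverts G"
    by (auto simp: local_complement_def open_nbhd_def dest: in_arcsD1 in_arcsD2 split: if_splits)
  have s: "(u, v) \<in> parcs G \<longleftrightarrow> (v, u) \<in> parcs G" for u v
    using arcs_symmetric by blast
  show ?thesis
  proof
    show "finite (parcs (local_complement G a))"
      using sub by (rule finite_subset) (simp add: pair_finite_verts)
    show "symmetric (local_complement G a)"
      unfolding symmetric_def sym_def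
      by (auto simp: local_complement_def s arcs_ends_def arc_to_ends_def with_proj_def split: if_splits)
  qed (auto simp: local_complement_def open_nbhd_def pair_finite_verts
         dest: in_arcsD1 in_arcsD2 no_loops' split: if_splits)
qed

lemma local_inversion_bicolorings:
  assumes "\<beta> \<in> bicolorings G"
  shows "snd (local_inversion (G, \<beta>) a) \<in> bicolorings (local_complement G a)"
  using assms by (auto simp: bicolorings_def local_complement_def open_nbhd_def PiE_iff extensional_def)

end

theory Submission
  imports Defs
begin

text \<open>
  Local inversions at \<open>u\<close>, \<open>v\<close>, \<open>u\<close>, for an edge \<open>uv\<close>, pivot the graph on \<open>uv\<close> and change exactly one
  color, that of \<open>u\<close> (\<open>apply_string_pivot\<close>): the three sets of recolored vertices cancel everywhere
  else. The pivots themselves obey a transitivity law: pivoting on \<open>cl\<close> and then on \<open>lm\<close> is the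
  same as pivoting on \<open>cm\<close> (\<open>pivot_pivot_trans\<close>), while pivoting on \<open>cl\<close> and then on \<open>lc\<close> does
  nothing (\<open>pivot_pivot_back\<close>).

  Let \<open>c\<close> be adjacent to \<open>l\<^sub>1, \<dots>, l\<^sub>k\<close>, with \<open>k \<ge> 1\<close>. Pivot on \<open>c l\<^sub>1\<close>, \<open>l\<^sub>1 l\<^sub>2\<close>, \<open>\<dots>\<close>, \<open>l\<^sub>k c\<close>. By
  transitivity the graph after \<open>j\<close> of these pivots is that of the single pivot on \<open>c l\<^sub>j\<close>, so the
  last pivot restores the original graph; and as each of the \<open>k + 1\<close> vertices of the star comes
  first in exactly one pivot, exactly these vertices change color. The string has length
  \<open>3(k + 1)\<close>, three times the number of vertices of the star (\<open>star_flip_string\<close>). Adjacencies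
  among the leaves, or between the star and other vertices, are arbitrary.

  The vertex set of a graph without isolated vertices is partitioned by stars with at least one
  leaf, because one can always remove a star without isolating any remaining vertex
  (\<open>peelable_star\<close>). Each star's string restores the graph, so the strings can be concatenated,
  and their lengths add up to \<open>3n\<close>.
\<close>

section \<open>Local complementation and edge pivots\<close>

lemma open_nbhd_iff:
  assumes "pair_graph G"
  shows "x \<in> open_nbhd G a \<longleftrightarrow> (a, x) \<in> parcs G"
proof -
  interpret pair_graph G by fact
  show ?thesis by (auto simp: open_nbhd_def dest: in_arcsD2)
qed

lemma pair_graph_arc_sym:
  assumes "pair_graph G"
  shows "(x, y) \<in> parcs G \<longleftrightarrow> (y, x) \<in> parcs G"
proof -
  interpret pair_graph G by fact
  show ?thesis using arcs_symmetric by blast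
qed

lemma pair_graph_no_loop:
  assumes "pair_graph G"
  shows "(x, x) \<notin> parcs G"
proof -
  interpret pair_graph G by fact
  show ?thesis using no_loops' by blast
qed

lemma pverts_local_complement [simp]: "pverts (local_complement G a) = pverts G"
  by (simp add: local_complement_def)

lemma arc_local_complement_iff:
  assumes "pair_graph G"
  shows "(x, y) \<in> parcs (local_complement G a) \<longleftrightarrow>
    ((x, y) \<in> parcs G) \<noteq> (x \<noteq> y \<and> (a, x) \<in> parcs G \<and> (a, y) \<in> parcs G)"
  using pair_graph_no_loop[OF assms]
  by (auto simp: local_complement_def open_nbhd_iff[OF assms])

definition pivot :: "'a pair_pre_digraph \<Rightarrow> 'a \<Rightarrow> 'a \<Rightarrow> 'a pair_pre_digraph" where
  "pivot G u v = local_complement (local_complement (local_complement G u) v) u"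

lemma pair_graph_pivot: "pair_graph G \<Longrightarrow> pair_graph (pivot G u v)"
  by (simp add: pivot_def pair_graph_local_complement)

lemma pverts_pivot [simp]: "pverts (pivot G u v) = pverts G"
  by (simp add: pivot_def)

text \<open>
  The classical description of a pivot: \<open>u\<close> and \<open>v\<close> exchange their neighborhoods, and \<open>xy\<close> is
  toggled when \<open>x\<close> and \<open>y\<close> lie in different ones of the three classes of vertices adjacent to
  \<open>u\<close> only, to \<open>v\<close> only, or to both. As an exclusive or, this is adding the rank-two form
  \<open>a\<^sub>u(x) a\<^sub>v(y) + a\<^sub>v(x) a\<^sub>u(y)\<close> over the two-element field, which makes compositions of pivots
  easy to compute.
\<close>

lemma arc_pivot_iff:
  assumes G: "pair_graph G" and uv: "(u, v) \<in> parcs G"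
  shows "(x, y) \<in> parcs (pivot G u v) \<longleftrightarrow>
    (if x \<in> {u, v} \<or> y \<in> {u, v}
     then (transpose u v x, transpose u v y) \<in> parcs G
     else (((x, y) \<in> parcs G) \<noteq> (x \<noteq> y \<and> (u, x) \<in> parcs G \<and> (v, y) \<in> parcs G))
       \<noteq> (x \<noteq> y \<and> (v, x) \<in> parcs G \<and> (u, y) \<in> parcs G))"
proof -
  note nl = pair_graph_no_loop[OF G] and sym = pair_graph_arc_sym[OF G]
  let ?A = "local_complement G u"
  let ?B = "local_complement ?A v"
  have gA: "pair_graph ?A" and gB: "pair_graph ?B"
    using G by (simp_all add: pair_graph_local_complement)
  have uv': "u \<noteq> v" "(v, u) \<in> parcs G" using uv nl sym by auto
  note A = arc_local_complement_iff[OF G, of _ _ u]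
  have Au: "(u, z) \<in> parcs ?A \<longleftrightarrow> (u, z) \<in> parcs G" for z
    using nl by (simp add: A)
  have Av: "(v, z) \<in> parcs ?A \<longleftrightarrow> ((v, z) \<in> parcs G) \<noteq> (v \<noteq> z \<and> (u, z) \<in> parcs G)" for z
    using uv by (simp add: A)
  have B: "(x, y) \<in> parcs ?B \<longleftrightarrow> ((x, y) \<in> parcs ?A) \<noteq> (x \<noteq> y \<and> (v, x) \<in> parcs ?A \<and> (v, y) \<in> parcs ?A)" for x y
    by (rule arc_local_complement_iff[OF gA])
  have Bu: "(u, z) \<in> parcs ?B \<longleftrightarrow> (if z = v then True else (v, z) \<in> parcs G \<and> z \<noteq> u)" for z
    using uv uv' nl by (auto simp: B Au Av)
  show ?thesis
    unfolding pivot_def arc_local_complement_iff[OF gB] Bu B Av A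
    using uv uv' nl sym by (auto simp: transpose_def)
qed

section \<open>Strings realising pivots\<close>

definition flip_colors :: "'a set \<Rightarrow> ('a \<Rightarrow> int) \<Rightarrow> 'a \<Rightarrow> int" where
  "flip_colors S \<beta> = (\<lambda>x. if x \<in> S then - \<beta> x else \<beta> x)"

lemma flip_colors_flip_colors:
  "S \<inter> T = {} \<Longrightarrow> flip_colors S (flip_colors T \<beta>) = flip_colors (S \<union> T) \<beta>"
  by (auto simp: flip_colors_def fun_eq_iff)

lemma apply_string_append: "apply_string B (v @ w) = apply_string (apply_string B v) w"
  by (simp add: apply_string_def)

text \<open>
  Let \<open>x \<noteq> u, v\<close> and write \<open>a\<^sub>u\<close>, \<open>a\<^sub>v\<close> for its adjacencies to \<open>u\<close> and \<open>v\<close> in \<open>G\<close>. The three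
  inversions recolor \<open>x\<close> according to \<open>a\<^sub>u\<close>, \<open>a\<^sub>u + a\<^sub>v\<close> and \<open>a\<^sub>v\<close>, which sum to zero modulo two. The
  vertices \<open>u\<close> and \<open>v\<close> stay adjacent, so \<open>v\<close> is recolored twice and \<open>u\<close> once.
\<close>

lemma apply_string_pivot:
  assumes G: "pair_graph G" and uv: "(u, v) \<in> parcs G"
  shows "apply_string (G, \<beta>) [u, v, u] = (pivot G u v, flip_colors {u} \<beta>)"
proof -
  note nl = pair_graph_no_loop[OF G] and sym = pair_graph_arc_sym[OF G]
  let ?A = "local_complement G u"
  let ?B = "local_complement ?A v"
  have gA: "pair_graph ?A" and gB: "pair_graph ?B"
    using G by (simp_all add: pair_graph_local_complement)
  have uv': "u \<noteq> v" "(v, u) \<in> parcs G" using uv nl sym by auto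
  have "z \<in> open_nbhd ?B u \<longleftrightarrow> z = v \<or> ((v, z) \<in> parcs G \<and> z \<noteq> u)"
    "z \<in> open_nbhd ?A v \<longleftrightarrow> ((v, z) \<in> parcs G) \<noteq> (v \<noteq> z \<and> (u, z) \<in> parcs G)"
    "z \<in> open_nbhd G u \<longleftrightarrow> (u, z) \<in> parcs G" for z
    using uv uv' nl
    by (auto simp: open_nbhd_iff[OF G] open_nbhd_iff[OF gA] open_nbhd_iff[OF gB]
        arc_local_complement_iff[OF G] arc_local_complement_iff[OF gA])
  then show ?thesis
    using uv uv' nl by (auto simp: apply_string_def pivot_def flip_colors_def fun_eq_iff)
qed

lemma pivot_pivot_back:
  assumes G: "pair_graph G" and cl: "(c, l) \<in> parcs G"
  shows "pivot (pivot G c l) l c = G"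
proof -
  note nl = pair_graph_no_loop[OF G] and sym = pair_graph_arc_sym[OF G]
  have lc: "(l, c) \<in> parcs (pivot G c l)"
    using cl by (simp add: arc_pivot_iff[OF G cl])
  have "(x, y) \<in> parcs (pivot (pivot G c l) l c) \<longleftrightarrow> (x, y) \<in> parcs G" for x y
    unfolding arc_pivot_iff[OF pair_graph_pivot[OF G] lc]
    unfolding arc_pivot_iff[OF G cl]
    using nl sym cl by (auto simp: transpose_def)
  then show ?thesis
    by (intro pair_pre_digraph.equality) auto
qed

text \<open>
  This is the graph form of the rule that principal pivots on vertex sets \<open>X\<close> and \<open>Y\<close> compose to
  the one on their symmetric difference, here \<open>{c, l}\<close> and \<open>{l, m}\<close>.
\<close>

lemma pivot_pivot_trans:
  assumes G: "pair_graph G" and cl: "(c, l) \<in> parcs G" and cm: "(c, m) \<in> parcs G" and "l \<noteq> m"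
  shows "(l, m) \<in> parcs (pivot G c l)" and "pivot (pivot G c l) l m = pivot G c m"
proof -
  note nl = pair_graph_no_loop[OF G] and sym = pair_graph_arc_sym[OF G]
  have d: "c \<noteq> l" "c \<noteq> m" using cl cm nl by auto
  show lm: "(l, m) \<in> parcs (pivot G c l)"
    using cl cm d \<open>l \<noteq> m\<close> by (simp add: arc_pivot_iff[OF G cl] transpose_def)
  have "(x, y) \<in> parcs (pivot (pivot G c l) l m) \<longleftrightarrow> (x, y) \<in> parcs (pivot G c m)" for x y
    unfolding arc_pivot_iff[OF pair_graph_pivot[OF G] lm]
    unfolding arc_pivot_iff[OF G cl] arc_pivot_iff[OF G cm]
    using nl sym cl cm d \<open>l \<noteq> m\<close>
    by (simp add: transpose_def, smt (verit))
  then show "pivot (pivot G c l) l m = pivot G c m"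
    by (intro pair_pre_digraph.equality) auto
qed

section \<open>Reversing a star\<close>

fun pivot_walk :: "'a list \<Rightarrow> 'a list" where
  "pivot_walk (u # v # xs) = [u, v, u] @ pivot_walk (v # xs)"
| "pivot_walk xs = []"

lemma length_pivot_walk: "length (pivot_walk xs) = 3 * (length xs - 1)"
  by (induction xs rule: pivot_walk.induct) auto

lemma set_pivot_walk: "set (pivot_walk xs) \<subseteq> set xs"
  by (induction xs rule: pivot_walk.induct) auto

text \<open>
  The walk is started after its first pivot, so that the induction can replace the pivots on \<open>cl\<close> and
  \<open>lm\<close> by the one on \<open>cm\<close> and remain in a graph of the form \<open>pivot G c m\<close> with the same \<open>G\<close>.
\<close>

lemma pivot_walk_return:
  assumes G: "pair_graph G"
    and "distinct (l # ls)" and "\<forall>x\<in>set (l # ls). (c, x) \<in> parcs G"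
  shows "apply_string (pivot G c l, \<beta>) (pivot_walk (l # ls @ [c])) =
    (G, flip_colors (set (l # ls)) \<beta>)"
  using assms(2-)
proof (induction ls arbitrary: l \<beta>)
  case Nil
  then have cl: "(c, l) \<in> parcs G" by simp
  have "(l, c) \<in> parcs (pivot G c l)"
    using cl by (simp add: arc_pivot_iff[OF G cl])
  then show ?case
    using apply_string_pivot[OF pair_graph_pivot[OF G]] pivot_pivot_back[OF G cl]
    by simp
next
  case (Cons m ls)
  then have "(c, l) \<in> parcs G" "(c, m) \<in> parcs G" "l \<noteq> m" by auto
  note trans = pivot_pivot_trans[OF G this]
  have "apply_string (pivot G c l, \<beta>) (pivot_walk (l # (m # ls) @ [c])) =
      apply_string (apply_string (pivot G c l, \<beta>) [l, m, l]) (pivot_walk (m # ls @ [c]))"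
    by (simp flip: apply_string_append)
  also have "\<dots> = apply_string (pivot G c m, flip_colors {l} \<beta>) (pivot_walk (m # ls @ [c]))"
    by (simp only: apply_string_pivot[OF pair_graph_pivot[OF G] trans(1)] trans(2))
  also have "\<dots> = (G, flip_colors (set (m # ls)) (flip_colors {l} \<beta>))"
    using Cons by simp
  also have "\<dots> = (G, flip_colors (set (l # m # ls)) \<beta>)"
    using Cons.prems(1) by (subst flip_colors_flip_colors) auto
  finally show ?case .
qed

lemma star_flip_string:
  assumes G: "pair_graph G" and "finite L" "L \<noteq> {}" and adj: "\<forall>x\<in>L. (c, x) \<in> parcs G"
  shows "\<exists>w. set w \<subseteq> insert c L \<and> length w = 3 * card (insert c L) \<and>
    (\<forall>\<beta>. apply_string (G, \<beta>) w = (G, flip_colors (insert c L) \<beta>))"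
proof -
  obtain ls where ls: "set ls = L" "distinct ls"
    using \<open>finite L\<close> finite_distinct_list by blast
  then obtain l ls' where eq: "ls = l # ls'"
    using \<open>L \<noteq> {}\<close> by (cases ls) auto
  have c: "c \<notin> L" using adj pair_graph_no_loop[OF G] by blast
  have cl: "(c, l) \<in> parcs G" using adj ls eq by auto
  let ?w = "pivot_walk (c # ls @ [c])"
  have "apply_string (G, \<beta>) ?w = (G, flip_colors (insert c L) \<beta>)" for \<beta>
  proof -
    have "apply_string (G, \<beta>) ?w =
        apply_string (apply_string (G, \<beta>) [c, l, c]) (pivot_walk (l # ls' @ [c]))"
      by (simp add: eq flip: apply_string_append)
    also have "\<dots> = (G, flip_colors (set (l # ls')) (flip_colors {c} \<beta>))"
      using ls adj unfolding apply_string_pivot[OF G cl]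
      by (intro pivot_walk_return[OF G]) (auto simp: eq)
    also have "\<dots> = (G, flip_colors (insert c L) \<beta>)"
      using c ls eq by (subst flip_colors_flip_colors) auto
    finally show ?thesis .
  qed
  moreover have "set ?w \<subseteq> insert c L"
    using set_pivot_walk[of "c # ls @ [c]"] ls by auto
  moreover have "length ?w = 3 * card (insert c L)"
    using c ls \<open>finite L\<close> by (simp add: length_pivot_walk distinct_card[symmetric])
  ultimately show ?thesis by blast
qed

section \<open>Peeling off stars\<close>

text \<open>
  Take an edge \<open>uv\<close> inside \<open>F\<close>, and remove it together with every vertex whose only neighbors in
  \<open>F\<close> are among \<open>u\<close> and \<open>v\<close>; no other vertex can become isolated. This is a star around \<open>u\<close> provided all
  the vertices isolated by the removal of \<open>uv\<close> are adjacent to \<open>u\<close>. If some vertex has a single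
  neighbor in \<open>F\<close>, take it as \<open>v\<close> and its neighbor as \<open>u\<close>: nothing else is adjacent to \<open>v\<close>. If all
  vertices have at least two neighbors in \<open>F\<close>, any edge will do, as a vertex isolated by its removal
  is adjacent to both ends.
\<close>

lemma peelable_star:
  assumes G: "pair_graph G" and "F \<noteq> {}"
    and cover: "\<forall>x\<in>F. \<exists>y\<in>F. (x, y) \<in> parcs G"
  obtains c L where "c \<in> F" "L \<subseteq> F" "L \<noteq> {}" "\<forall>x\<in>L. (c, x) \<in> parcs G"
    "\<forall>x\<in>F - insert c L. \<exists>y\<in>F - insert c L. (x, y) \<in> parcs G"
proof -
  note nl = pair_graph_no_loop[OF G] and sym = pair_graph_arc_sym[OF G]
  obtain u v where uv: "u \<in> F" "v \<in> F" "(u, v) \<in> parcs G"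
    and deg: "(\<forall>y\<in>F. (v, y) \<in> parcs G \<longrightarrow> y = u) \<or>
      (\<forall>x\<in>F. \<forall>z. \<exists>y\<in>F. (x, y) \<in> parcs G \<and> y \<noteq> z)"
  proof (cases "\<forall>x\<in>F. \<forall>z. \<exists>y\<in>F. (x, y) \<in> parcs G \<and> y \<noteq> z")
    case True
    then show ?thesis using that cover \<open>F \<noteq> {}\<close> by blast
  next
    case False
    then obtain v z where "v \<in> F" "\<forall>y\<in>F. (v, y) \<in> parcs G \<longrightarrow> y = z" by blast
    then show ?thesis using that[of z v] cover sym by blast
  qed
  define M where "M = {x \<in> F - {u, v}. \<forall>y\<in>F. (x, y) \<in> parcs G \<longrightarrow> y \<in> {u, v}}"
  have M: "(u, x) \<in> parcs G" if "x \<in> M" for x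
    using that deg cover sym unfolding M_def by blast
  \<comment> \<open>A surviving vertex keeps its neighbor outside \<open>{u, v}\<close>: that neighbor is not in \<open>M\<close>, as
    vertices in \<open>M\<close> have no neighbors outside \<open>{u, v}\<close>.\<close>
  have "\<exists>y\<in>F - insert u (insert v M). (x, y) \<in> parcs G" if "x \<in> F - insert u (insert v M)" for x
    using that sym unfolding M_def by blast
  then show ?thesis
    using that[of u "insert v M"] uv M unfolding M_def by blast
qed

lemma flip_string_exists:
  assumes G: "pair_graph G" and "F \<subseteq> pverts G"
    and "\<forall>x\<in>F. \<exists>y\<in>F. (x, y) \<in> parcs G"
  shows "\<exists>w. set w \<subseteq> F \<and> length w = 3 * card F \<and>
    (\<forall>\<beta>. apply_string (G, \<beta>) w = (G, flip_colors F \<beta>))"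
proof -
  interpret pair_graph G by fact
  have "finite F" using assms(2) pair_finite_verts finite_subset by blast
  then show ?thesis using assms(3)
  proof (induction F rule: finite_psubset_induct)
    case (psubset F)
    show ?case
    proof (cases "F = {}")
      case True
      then show ?thesis
        by (intro exI[of _ "[]"]) (auto simp: apply_string_def flip_colors_def)
    next
      case False
      obtain c L where cL: "c \<in> F" "L \<subseteq> F" "L \<noteq> {}" "\<forall>x\<in>L. (c, x) \<in> parcs G"
        and rest: "\<forall>x\<in>F - insert c L. \<exists>y\<in>F - insert c L. (x, y) \<in> parcs G"
        using peelable_star[OF G False psubset.prems] .
      let ?T = "insert c L" and ?R = "F - insert c L"
      have fin: "finite L" using cL(2) psubset.hyps finite_subset by blast
      obtain v where v: "set v \<subseteq> ?T" "length v = 3 * card ?T"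
        "\<forall>\<beta>. apply_string (G, \<beta>) v = (G, flip_colors ?T \<beta>)"
        using star_flip_string[OF G fin cL(3,4)] by blast
      have "?R \<subset> F" using cL(1) by blast
      from psubset.IH[OF this rest] obtain w where w: "set w \<subseteq> ?R" "length w = 3 * card ?R"
        "\<forall>\<beta>. apply_string (G, \<beta>) w = (G, flip_colors ?R \<beta>)" by blast
      have "?T \<subseteq> F" using cL by blast
      then have "?R \<union> ?T = F" and card: "card ?T + card ?R = card F"
        using psubset.hyps fin by (auto simp: card_Diff_subset card_mono)
      then have "\<forall>\<beta>. apply_string (G, \<beta>) (v @ w) = (G, flip_colors F \<beta>)"
        using v(3) w(3) flip_colors_flip_colors[of ?R ?T]
        by (simp add: apply_string_append Int_commute)
      moreover have "set (v @ w) \<subseteq> F" using v(1) w(1) \<open>?T \<subseteq> F\<close> by auto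
      moreover have "length (v @ w) = 3 * card F" using v(2) w(2) card by simp
      ultimately show ?thesis by blast
    qed
  qed
qed

theorem corollary1:
  fixes G :: "'a pair_pre_digraph" and n :: nat
  assumes "pair_graph G"
    and "card (pverts G) = n"
    and "\<nexists>v. isolated_vertex G v"
  shows "color_reversal_number G \<le> enat (3 * n)"
proof -
  have "\<forall>x\<in>pverts G. \<exists>y\<in>pverts G. (x, y) \<in> parcs G"
    using assms(3) by (auto simp: isolated_vertex_def open_nbhd_def)
  then obtain w where w: "set w \<subseteq> pverts G" "length w = 3 * n"
    "\<forall>\<beta>. apply_string (G, \<beta>) w = (G, flip_colors (pverts G) \<beta>)"
    using flip_string_exists[OF assms(1) subset_refl] assms(2) by blast
  have "flip_colors (pverts G) \<beta> = color_negation G \<beta>" if "\<beta> \<in> bicolorings G" for \<beta>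
    using that by (auto simp: flip_colors_def color_negation_def bicolorings_def
        PiE_iff extensional_def fun_eq_iff)
  then have "color_reversing G w"
    using w by (simp add: color_reversing_def)
  then show ?thesis
    unfolding color_reversal_number_def w(2)[symmetric] by (intro INF_lower) simp
qed

end
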